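(* Let $(A,\|\cdot\|)$ be a functionally continuous normed algebra with unit $e\neq 0$. Then the following assertions are equivalent: (1) $A$ is a saturated normed algebra; (2) $A$ is a uniform normed algebra.
   Context: Algebras are associative over $\mathbb{C}$, not necessarily commutative; a normed algebra is an algebra with a submultiplicative norm (not necessarily complete). $M^*(A)$ denotes the set of all nonzero multiplicative linear functionals $A\to\mathbb{C}$, and $M(A)$ the subset of the continuous ones. $A$ is functionally continuous if $M^*(A)=M(A)$. A saturated normed algebra is a normed algebra $(A,\|\cdot\|)$ with unit $e$ such that (a) $\|e\|=1$, and (b) for all $x\in A$ with $\|x\|=1$, there exist $f_0,f\in M^*(A)$ such that $|f_0(x)|=\sup\{|f(y)|: y\in A,\ \|y\|\le 1\}$. A uniform normed algebra is a normed algebra $(A,\|\cdot\|)$ such that $\|x^2\|=\|x\|^2$ for all $x\in A$. *)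

theory Defs
  imports Complex_Main "HOL-Library.Extended_Real"
begin

(* The real structure inherited from real_normed_algebra is the restriction of
   the complex one; completeness and a unit are not assumed. *)
class complex_normed_algebra = real_normed_algebra +
  fixes scaleC :: "complex \<Rightarrow> 'a \<Rightarrow> 'a"  (infixr "*\<^sub>C" 75)
  assumes scaleR_scaleC: "r *\<^sub>R x = complex_of_real r *\<^sub>C x"
    and scaleC_add_right: "c *\<^sub>C (x + y) = c *\<^sub>C x + c *\<^sub>C y"
    and scaleC_add_left: "(c + d) *\<^sub>C x = c *\<^sub>C x + d *\<^sub>C x"
    and scaleC_scaleC: "c *\<^sub>C d *\<^sub>C x = (c * d) *\<^sub>C x"
    and scaleC_one: "1 *\<^sub>C x = x"
    and mult_scaleC_left: "(c *\<^sub>C x) * y = c *\<^sub>C (x * y)"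
    and mult_scaleC_right: "x * (c *\<^sub>C y) = c *\<^sub>C (x * y)"
    and norm_scaleC: "norm (c *\<^sub>C x) = cmod c * norm x"

definition multiplicative_functionals :: "('a::complex_normed_algebra \<Rightarrow> complex) set" where
  "multiplicative_functionals =
     {f. (\<forall>x y. f (x + y) = f x + f y) \<and> (\<forall>c x. f (c *\<^sub>C x) = c * f x) \<and>
         (\<forall>x y. f (x * y) = f x * f y) \<and> (\<exists>x. f x \<noteq> 0)}"

definition continuous_multiplicative_functionals ::
    "('a::complex_normed_algebra \<Rightarrow> complex) set" where
  "continuous_multiplicative_functionals =
     {f \<in> multiplicative_functionals. continuous_on UNIV f}"

definition functionally_continuous :: "'a::complex_normed_algebra itself \<Rightarrow> bool" where
  "functionally_continuous _ \<longleftrightarrow>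
     (multiplicative_functionals :: ('a \<Rightarrow> complex) set) = continuous_multiplicative_functionals"

(* The unit comes from ring_1 and not from real_normed_algebra_1, since the
   latter already forces norm 1 = 1. The supremum is taken in ereal because f is
   not assumed continuous; the equality therefore includes its finiteness. *)
definition saturated_normed_algebra :: "'a::{complex_normed_algebra, ring_1} itself \<Rightarrow> bool" where
  "saturated_normed_algebra _ \<longleftrightarrow>
     norm (1::'a) = 1 \<and>
     (\<forall>x::'a. norm x = 1 \<longrightarrow>
        (\<exists>f0 \<in> multiplicative_functionals. \<exists>f \<in> multiplicative_functionals.
           ereal (cmod (f0 x)) = (SUP y \<in> {y::'a. norm y \<le> 1}. ereal (cmod (f y)))))"

definition uniform_normed_algebra :: "'a::complex_normed_algebra itself \<Rightarrow> bool" where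
  "uniform_normed_algebra _ \<longleftrightarrow> (\<forall>x::'a. norm (x * x) = (norm x)\<^sup>2)"

end

theory Submission
  imports Defs "HOL-Analysis.Topology_Euclidean_Space"
begin

text \<open>A continuous multiplicative functional has norm 1, so saturation says that each unit vector
  \<open>x\<close> satisfies \<open>|f x| = 1\<close> for some \<open>f\<close>; then \<open>1 = |f (x\<^sup>2)| \<le> \<parallel>x\<^sup>2\<parallel>\<close>. Conversely, a uniform
  algebra is commutative by a Liouville argument. Such an \<open>f\<close> is found without passing to the
  completion: a minimal uniform seminorm \<open>p\<close> with \<open>p x = 1\<close> is multiplicative, and by
  Gelfand--Mazur a multiplicative seminorm is the modulus of a multiplicative functional.\<close>

section \<open>Complex scalar arithmetic and powers\<close>

lemma scaleC_zero_left [simp]: "0 *\<^sub>C x = (0::'a::complex_normed_algebra)"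
  using norm_scaleC[of 0 x] by simp

lemma scaleC_zero_right [simp]: "c *\<^sub>C 0 = (0::'a::complex_normed_algebra)"
  using norm_scaleC[of c "0::'a"] by simp

lemma scaleC_minus_left: "(- c) *\<^sub>C x = - (c *\<^sub>C (x::'a::complex_normed_algebra))"
  using scaleC_add_left[of "-c" c x] by (simp add: eq_neg_iff_add_eq_0)

lemma scaleC_minus_right: "c *\<^sub>C (- x) = - (c *\<^sub>C (x::'a::complex_normed_algebra))"
  using scaleC_add_right[of c "-x" x] by (simp add: eq_neg_iff_add_eq_0)

lemma scaleC_diff_left: "(c - d) *\<^sub>C x = c *\<^sub>C x - d *\<^sub>C (x::'a::complex_normed_algebra)"
  using scaleC_add_left[of c "-d" x] by (simp add: scaleC_minus_left)

lemma scaleC_diff_right: "c *\<^sub>C (x - y) = c *\<^sub>C x - c *\<^sub>C (y::'a::complex_normed_algebra)"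
  using scaleC_add_right[of c x "-y"] by (simp add: scaleC_minus_right)

lemma scaleC_sum_right: "c *\<^sub>C sum g A = (\<Sum>i\<in>A. c *\<^sub>C (g i :: 'a::complex_normed_algebra))"
  by (induction A rule: infinite_finite_induct) (auto simp: scaleC_add_right)

lemma scaleC_sum_left: "sum g A *\<^sub>C x = (\<Sum>i\<in>A. g i *\<^sub>C (x :: 'a::complex_normed_algebra))"
  by (induction A rule: infinite_finite_induct) (auto simp: scaleC_add_left)

lemma mult_power_commuting:
  fixes x y :: "'a::monoid_mult"
  assumes "x * y = y * x"
  shows "x ^ n * y ^ n = (x * y) ^ n"
proof (induction n)
  case (Suc n)
  have "x ^ Suc n * y ^ Suc n = x * (x ^ n * y) * y ^ n"
    by (simp add: mult.assoc)
  also have "x ^ n * y = y * x ^ n"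
    using power_commuting_commutes[OF assms] .
  finally show ?case
    by (simp add: mult.assoc flip: Suc.IH)
qed simp

text \<open>The exponent starts at 1 because \<open>ring_1\<close> does not provide
  \<open>norm 1 \<le> 1\<close>.\<close>

lemma norm_power_Suc_le:
  fixes x :: "'a::{real_normed_algebra, ring_1}"
  shows "norm (x ^ Suc n) \<le> norm x ^ Suc n"
proof (induction n)
  case (Suc n)
  have "norm (x ^ Suc (Suc n)) \<le> norm x * norm (x ^ Suc n)"
    by (metis norm_mult_ineq power_Suc)
  also have "\<dots> \<le> norm x * norm x ^ Suc n"
    using Suc.IH by (rule mult_left_mono) simp
  finally show ?case by simp
qed simp


section \<open>Multiplicative functionals\<close>

lemma
  assumes "f \<in> multiplicative_functionals"
  shows mult_functional_add: "f (x + y) = f x + f y"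
    and mult_functional_scaleC: "f (c *\<^sub>C x) = c * f x"
    and mult_functional_mult: "f (x * y) = f x * f y"
    and mult_functional_nonzero: "\<exists>x. f x \<noteq> 0"
  using assms by (auto simp: multiplicative_functionals_def)

lemma mult_functional_one:
  fixes f :: "'a::{complex_normed_algebra, ring_1} \<Rightarrow> complex"
  assumes "f \<in> multiplicative_functionals"
  shows "f 1 = 1"
proof -
  obtain x where x: "f x \<noteq> 0" using mult_functional_nonzero[OF assms] by blast
  have "f x = f x * f 1" using mult_functional_mult[OF assms, of x 1] by simp
  thus ?thesis using x by simp
qed

lemma mult_functional_power:
  fixes f :: "'a::{complex_normed_algebra, ring_1} \<Rightarrow> complex"
  assumes "f \<in> multiplicative_functionals"
  shows "f (x ^ n) = f x ^ n"
  by (induction n) (auto simp: mult_functional_one mult_functional_mult assms)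

text \<open>If this failed, scaling \<open>y\<close> by \<open>inverse (f y)\<close> would give
  \<open>z\<close> with \<open>f z = 1\<close> and \<open>norm z < 1\<close>; the powers of
  \<open>z\<close> then tend to 0 while \<open>f\<close> maps each of them to 1, against
  continuity.\<close>

lemma continuous_mult_functional_le_norm:
  fixes f :: "'a::{complex_normed_algebra, ring_1} \<Rightarrow> complex"
  assumes "f \<in> continuous_multiplicative_functionals"
  shows "cmod (f y) \<le> norm y"
proof (rule ccontr)
  assume "\<not> ?thesis"
  hence less: "norm y < cmod (f y)" by simp
  have f: "f \<in> multiplicative_functionals" and cont: "continuous_on UNIV f"
    using assms by (auto simp: continuous_multiplicative_functionals_def)
  have fy: "cmod (f y) > 0" using less norm_ge_zero[of y] by linarith
  define z where "z = inverse (f y) *\<^sub>C y"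
  have fz: "f z = 1" using fy by (simp add: z_def mult_functional_scaleC f)
  have nz: "norm z < 1"
    using less fy by (simp add: z_def norm_scaleC norm_inverse flip: divide_inverse_commute)
  have "(\<lambda>n. norm z ^ Suc n) \<longlonglongrightarrow> 0"
    using nz by (intro LIMSEQ_Suc LIMSEQ_realpow_zero) auto
  hence "(\<lambda>n. z ^ Suc n) \<longlonglongrightarrow> 0"
    by (rule Lim_null_comparison[rotated]) (intro always_eventually allI norm_power_Suc_le)
  hence "(\<lambda>n. f (z ^ Suc n)) \<longlonglongrightarrow> f 0"
    using cont by (auto intro: continuous_on_tendsto_compose)
  moreover have "f 0 = 0" using mult_functional_add[OF f, of 0 0] by simp
  ultimately have "(\<lambda>n::nat. 1::complex) \<longlonglongrightarrow> 0"
    by (simp only: mult_functional_power[OF f] fz power_one)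
  thus False by (simp add: tendsto_const_iff)
qed


section \<open>Uniform seminorms\<close>

text \<open>Homogeneity is demanded only as an inequality, the form that passes directly to limits
  and infima; \<open>scaleC\<close> recovers equality by rescaling with
  \<open>inverse c\<close>.\<close>

locale uniform_seminorm =
  fixes p :: "'a::{complex_normed_algebra, ring_1} \<Rightarrow> real"
  assumes nonneg: "p a \<ge> 0"
    and add_le: "p (a + b) \<le> p a + p b"
    and scaleC_le: "p (c *\<^sub>C a) \<le> cmod c * p a"
    and mult_le: "p (a * b) \<le> p a * p b"
    and square: "p (a * a) = (p a)\<^sup>2"
    and one: "p 1 = 1"
begin

lemma zero [simp]: "p 0 = 0"
  using scaleC_le[of 0 0] nonneg[of 0] by simp

lemma scaleC: "p (c *\<^sub>C a) = cmod c * p a"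
proof (cases "c = 0")
  case False
  have "cmod c * p a = cmod c * p (inverse c *\<^sub>C c *\<^sub>C a)"
    using False by (simp add: scaleC_scaleC scaleC_one)
  also have "\<dots> \<le> cmod c * (cmod (inverse c) * p (c *\<^sub>C a))"
    by (intro mult_left_mono scaleC_le) auto
  also have "\<dots> = p (c *\<^sub>C a)" using False by (simp add: norm_inverse)
  finally show ?thesis using scaleC_le[of c a] by simp
qed simp

lemma minus: "p (- a) = p a"
  using scaleC[of "-1" a] by (simp add: scaleC_minus_left scaleC_one)

lemma diff_le: "p (a - b) \<le> p a + p b"
  using add_le[of a "- b"] by (simp add: minus)

lemma power_le: "p (a ^ n) \<le> p a ^ n"
proof (induction n)
  case (Suc n)
  have "p (a ^ Suc n) \<le> p a * p (a ^ n)" using mult_le[of a "a ^ n"] by simp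
  also have "\<dots> \<le> p a * p a ^ n" using Suc.IH nonneg by (rule mult_left_mono)
  finally show ?case by simp
qed (simp add: one)

lemma power_two_power: "p (a ^ (2 ^ k)) = p a ^ (2 ^ k)"
proof (induction k)
  case (Suc k)
  have "a ^ (2 ^ Suc k) = a ^ (2 ^ k) * a ^ (2 ^ k)" by (simp add: mult_2 power_add)
  thus ?case by (simp add: square Suc.IH mult.commute flip: power_mult)
qed simp

text \<open>Iterated squaring settles the exponents \<open>2 ^ k\<close>. For general
  \<open>n\<close>, split \<open>a ^ (2 ^ n)\<close> into \<open>a ^ n\<close> and
  \<open>a ^ (2 ^ n - n)\<close>, bound the second factor by submultiplicativity and cancel.\<close>

lemma power: "p (a ^ n) = p a ^ n"
proof (cases "p a = 0 \<or> n = 0")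
  case True
  thus ?thesis using power_le[of a n] nonneg[of "a ^ n"] one by (auto simp: power_0_left)
next
  case False
  hence pa: "p a > 0" using nonneg[of a] by simp
  have n: "n < 2 ^ n" by (rule less_exp)
  have "p a ^ n * p a ^ (2 ^ n - n) = p (a ^ (2 ^ n))"
    using n by (simp add: power_two_power flip: power_add)
  also have "a ^ (2 ^ n) = a ^ n * a ^ (2 ^ n - n)"
    using n by (simp flip: power_add)
  also have "p \<dots> \<le> p (a ^ n) * p (a ^ (2 ^ n - n))" by (rule mult_le)
  also have "\<dots> \<le> p (a ^ n) * p a ^ (2 ^ n - n)"
    by (intro mult_left_mono power_le nonneg)
  finally show ?thesis using pa power_le[of a n] by simp
qed

text \<open>The familiar equality of the spectral radii of \<open>a * b\<close> and
  \<open>b * a\<close>: as \<open>(a * b) ^ Suc n = a * (b * a) ^ n * b\<close> and \<open>p\<close>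
  respects powers, the two values differ at most by a constant factor after raising to large
  powers.\<close>

lemma mult_le_swap: "p (a * b) \<le> p (b * a)"
proof (rule ccontr)
  assume "\<not> ?thesis"
  hence less: "p (b * a) < p (a * b)" by simp
  define t where "t = p (a * b)"
  define s where "s = p (b * a)"
  have st: "0 \<le> s" "s < t" using less nonneg by (auto simp: s_def t_def)
  have prod: "(a * b) ^ Suc n = a * (b * a) ^ n * b" for n
    by (induction n) (simp_all add: mult.assoc flip: power_Suc2)
  have "t \<le> (p a * p b) * (s / t) ^ n" for n
  proof -
    have "t ^ Suc n = p (a * (b * a) ^ n * b)" by (simp only: t_def prod flip: power)
    also have "\<dots> \<le> p (a * (b * a) ^ n) * p b" by (rule mult_le)
    also have "\<dots> \<le> (p a * p ((b * a) ^ n)) * p b" by (intro mult_right_mono mult_le nonneg)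
    also have "\<dots> = (p a * p b) * s ^ n" by (simp add: power s_def)
    finally show ?thesis using st by (simp add: field_simps)
  qed
  moreover have "(\<lambda>n. (p a * p b) * (s / t) ^ n) \<longlonglongrightarrow> (p a * p b) * 0"
    using st by (intro tendsto_intros LIMSEQ_realpow_zero) auto
  ultimately have "t \<le> (p a * p b) * 0" by (intro LIMSEQ_le_const) auto
  thus False using st by simp
qed

end

lemma uniform_seminorm_norm:
  assumes "uniform_normed_algebra TYPE('a::{complex_normed_algebra, ring_1})"
  shows "uniform_seminorm (norm :: 'a \<Rightarrow> real)"
proof
  have sq: "norm (a * a) = (norm a)\<^sup>2" for a :: 'a
    using assms by (simp add: uniform_normed_algebra_def)
  show "norm (a * a) = (norm a)\<^sup>2" for a :: 'a by (rule sq)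
  show "norm (1::'a) = 1" using sq[of 1] by (simp add: power2_eq_square)
qed (auto simp: norm_triangle_ineq norm_scaleC norm_mult_ineq)


section \<open>Commutativity of uniform normed algebras\<close>

text \<open>A geometric sum with ratio \<open>w\<close>: \<open>w \<noteq> 1\<close> because
  \<open>N\<close> does not divide \<open>m\<close>, while \<open>w ^ N = 1\<close>.\<close>

lemma sum_roots_of_unity_power:
  assumes "N > 0" "\<not> N dvd m"
  shows "(\<Sum>j<N. cis (2 * pi / real N) ^ (j * m)) = 0"
proof -
  define w where "w = cis (2 * pi / real N) ^ m"
  have w: "w = cis (2 * pi * real m / real N)" by (simp add: w_def DeMoivre field_simps)
  have "w \<noteq> 1"
  proof
    assume "w = 1"
    then obtain i :: int where "2 * pi * real m / real N = of_int i * (2 * pi)"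
      unfolding w by (auto simp: complex_eq_iff cos_one_2pi_int)
    hence "real m = of_int i * real N" using assms by (simp add: field_simps)
    hence "int m = i * int N" by (metis of_int_eq_iff of_int_mult of_int_of_nat_eq)
    hence "int N dvd int m" by simp
    thus False using assms by simp
  qed
  moreover have "w ^ N = cis (2 * pi * real m)"
    using assms by (simp add: w DeMoivre)
  hence "w ^ N = 1" by (simp only: cis_multiple_2pi Ints_of_nat)
  ultimately have "(\<Sum>j<N. w ^ j) = 0" by (simp add: sum_gp_strict)
  thus ?thesis by (simp add: w_def mult.commute flip: power_mult)
qed

text \<open>Averaging over the \<open>N\<close>-th roots of unity plays the role of the Cauchy integral.\<close>

lemma polynomial_cauchy_estimate:
  fixes c :: "nat \<Rightarrow> 'a::complex_normed_algebra"
  assumes N: "N \<ge> 2" and r: "r \<ge> 0"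
    and bound: "\<And>z. cmod z = r \<Longrightarrow> norm (\<Sum>k<N. z ^ k *\<^sub>C c k) \<le> B"
  shows "r * norm (c 1) \<le> B"
proof -
  define w where "w = cis (2 * pi / real N)"
  define z where "z j = complex_of_real r * w ^ j" for j
  have wN: "w ^ N = 1" using N by (simp add: w_def DeMoivre)
  \<comment> \<open>The weight \<open>w ^ (j * (N - 1))\<close> equals \<open>w\<close> to the power
    \<open>-j\<close>, so summing over \<open>j\<close> isolates the linear coefficient: for
    \<open>k < N\<close>, \<open>N\<close> divides \<open>N - 1 + k\<close> only when
    \<open>k = 1\<close>.\<close>
  have ortho: "(\<Sum>j<N. w ^ (j * (N - 1)) * z j ^ k) = (if k = 1 then of_nat N * of_real r else 0)"
    if "k < N" for k
  proof -
    have "w ^ (j * (N - 1)) * z j ^ k = of_real r ^ k * w ^ (j * (N - 1 + k))" for j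
      unfolding z_def distrib_left power_add power_mult_distrib
      by (simp add: mult_ac flip: power_mult)
    hence "(\<Sum>j<N. w ^ (j * (N - 1)) * z j ^ k) = of_real r ^ k * (\<Sum>j<N. w ^ (j * (N - 1 + k)))"
      by (simp only: sum_distrib_left)
    also have "(\<Sum>j<N. w ^ (j * (N - 1 + k))) = (if k = 1 then of_nat N else 0)"
    proof (cases "k = 1")
      case True
      hence "N - 1 + k = N" using N by simp
      moreover have "w ^ (j * N) = 1" for j by (metis wN mult.commute power_mult power_one)
      ultimately show ?thesis using True by simp
    next
      case False
      have "\<not> N dvd N - 1 + k"
      proof
        assume d: "N dvd N - 1 + k"
        show False
        proof (cases "k = 0")
          case True
          with d N show False by (auto dest: dvd_imp_le)
        next
          case k: False
          have "N - 1 + k = N + (k - 1)" using k N by simp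
          hence "N dvd k - 1" using d by simp
          thus False using False k \<open>k < N\<close> by (auto dest!: dvd_imp_le)
        qed
      qed
      thus ?thesis using False N by (simp add: w_def sum_roots_of_unity_power)
    qed
    finally show ?thesis by auto
  qed
  have "(\<Sum>j<N. w ^ (j * (N - 1)) *\<^sub>C (\<Sum>k<N. z j ^ k *\<^sub>C c k))
      = (\<Sum>k<N. (\<Sum>j<N. w ^ (j * (N - 1)) * z j ^ k) *\<^sub>C c k)"
    unfolding scaleC_sum_right scaleC_sum_left scaleC_scaleC by (rule sum.swap)
  also have "\<dots> = (\<Sum>k<N. (if k = 1 then of_nat N * of_real r else 0) *\<^sub>C c k)"
    by (intro sum.cong refl) (simp only: ortho lessThan_iff)
  also have "\<dots> = (\<Sum>k<N. if k = 1 then (of_nat N * of_real r) *\<^sub>C c 1 else 0)"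
    by (intro sum.cong) auto
  also have "\<dots> = (of_nat N * of_real r) *\<^sub>C c 1" using N by (simp add: sum.delta)
  finally have "real N * (r * norm (c 1))
      = norm (\<Sum>j<N. w ^ (j * (N - 1)) *\<^sub>C (\<Sum>k<N. z j ^ k *\<^sub>C c k))"
    using r by (simp add: norm_scaleC norm_mult)
  also have "\<dots> \<le> (\<Sum>j<N. B)"
  proof (rule sum_norm_le)
    fix j
    have "norm (w ^ (j * (N - 1)) *\<^sub>C (\<Sum>k<N. z j ^ k *\<^sub>C c k)) = norm (\<Sum>k<N. z j ^ k *\<^sub>C c k)"
      by (simp add: norm_scaleC norm_power w_def)
    also have "\<dots> \<le> B"
      using r by (intro bound) (simp add: z_def norm_mult norm_power w_def)
    finally show "norm (w ^ (j * (N - 1)) *\<^sub>C (\<Sum>k<N. z j ^ k *\<^sub>C c k)) \<le> B" .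
  qed
  finally show ?thesis using N by simp
qed

text \<open>Only the two lowest coefficients are tracked, since no others enter the argument.
  \<open>N \<ge> 2\<close> puts \<open>c 1\<close> inside the sum, and the vanishing tail lets the
  range of summation be extended.\<close>

definition polynomial_with_coeffs01 ::
    "(complex \<Rightarrow> 'a::complex_normed_algebra) \<Rightarrow> 'a \<Rightarrow> 'a \<Rightarrow> bool" where
  "polynomial_with_coeffs01 P c0 c1 \<longleftrightarrow>
     (\<exists>c N. N \<ge> 2 \<and> c 0 = c0 \<and> c 1 = c1 \<and> (\<forall>k\<ge>N. c k = 0) \<and>
            (\<forall>z. P z = (\<Sum>k<N. z ^ k *\<^sub>C c k)))"

lemma polynomial_with_coeffs01_const: "polynomial_with_coeffs01 (\<lambda>z. b) b 0"
  unfolding polynomial_with_coeffs01_def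
  by (intro exI[of _ "\<lambda>k. if k = 0 then b else 0"] exI[of _ 2])
     (auto simp: numeral_2_eq_2 scaleC_one)

text \<open>Composition with \<open>1 + z L\<close> for a linear map \<open>L\<close>: the shift by
  one degree sends \<open>c0\<close> into the linear coefficient. It serves for multiplication by
  \<open>1 + z a\<close> on the left and by \<open>1 - z a\<close> on the right.\<close>

lemma polynomial_with_coeffs01_step:
  assumes P: "polynomial_with_coeffs01 P c0 c1"
    and add: "\<And>x y. L (x + y) = L x + L y"
    and scale: "\<And>c x. L (c *\<^sub>C x) = c *\<^sub>C L x"
  shows "polynomial_with_coeffs01 (\<lambda>z. P z + z *\<^sub>C L (P z)) c0 (c1 + L c0)"
proof -
  obtain c N where c: "N \<ge> 2" "c 0 = c0" "c 1 = c1" "\<forall>k\<ge>N. c k = 0"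
      "\<forall>z. P z = (\<Sum>k<N. z ^ k *\<^sub>C c k)"
    using P unfolding polynomial_with_coeffs01_def by blast
  have L0: "L 0 = 0" using add[of 0 0] by simp
  have L_sum: "L (sum g A) = (\<Sum>i\<in>A. L (g i))" for g and A :: "nat set"
    by (induction A rule: infinite_finite_induct) (auto simp: L0 add)
  define c' where "c' k = c k + (if k = 0 then 0 else L (c (k - 1)))" for k
  have "P z + z *\<^sub>C L (P z) = (\<Sum>k<Suc N. z ^ k *\<^sub>C c' k)" for z
  proof -
    have "(\<Sum>k<Suc N. z ^ k *\<^sub>C c' k) = (\<Sum>k<Suc N. z ^ k *\<^sub>C c k)
        + (\<Sum>k<Suc N. z ^ k *\<^sub>C (if k = 0 then 0 else L (c (k - 1))))"
      by (simp only: c'_def scaleC_add_right sum.distrib)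
    also have "(\<Sum>k<Suc N. z ^ k *\<^sub>C c k) = P z" using c by simp
    also have "(\<Sum>k<Suc N. z ^ k *\<^sub>C (if k = 0 then 0 else L (c (k - 1))))
        = (\<Sum>k<N. z ^ Suc k *\<^sub>C L (c k))"
      by (subst sum.lessThan_Suc_shift) simp
    also have "\<dots> = z *\<^sub>C L (P z)"
      using c(5) by (simp add: L_sum scale scaleC_sum_right scaleC_scaleC)
    finally show ?thesis by simp
  qed
  thus ?thesis unfolding polynomial_with_coeffs01_def
    using c by (intro exI[of _ c'] exI[of _ "Suc N"]) (auto simp: c'_def L0)
qed

text \<open>Each induction step multiplies on both sides; the left factor contributes
  \<open>a * b\<close> and the right factor \<open>- (b * a)\<close> to the linear
  coefficient.\<close>

lemma polynomial_with_coeffs01_conjugate: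
  fixes a b :: "'a::{complex_normed_algebra, ring_1}"
  shows "polynomial_with_coeffs01 (\<lambda>z. (1 + z *\<^sub>C a) ^ n * b * (1 - z *\<^sub>C a) ^ n)
           b (real n *\<^sub>R (a * b - b * a))"
proof (induction n)
  case 0
  show ?case using polynomial_with_coeffs01_const[of b] by simp
next
  case (Suc n)
  define P where "P z = (1 + z *\<^sub>C a) ^ n * b * (1 - z *\<^sub>C a) ^ n" for z
  define Q where "Q z = P z + z *\<^sub>C (a * P z)" for z
  have "polynomial_with_coeffs01 Q b (real n *\<^sub>R (a * b - b * a) + a * b)"
    unfolding Q_def using Suc.IH[folded P_def]
    by (rule polynomial_with_coeffs01_step) (simp_all add: distrib_left mult_scaleC_right)
  hence "polynomial_with_coeffs01 (\<lambda>z. Q z + z *\<^sub>C (- (Q z * a))) b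
      (real n *\<^sub>R (a * b - b * a) + a * b + - (b * a))"
    by (rule polynomial_with_coeffs01_step)
       (simp_all add: distrib_right mult_scaleC_left scaleC_minus_right)
  moreover have "Q z + z *\<^sub>C (- (Q z * a)) = (1 + z *\<^sub>C a) ^ Suc n * b * (1 - z *\<^sub>C a) ^ Suc n" for z
  proof -
    have "Q z = (1 + z *\<^sub>C a) * P z"
      by (simp add: Q_def distrib_right mult_scaleC_left)
    moreover have "Q z + z *\<^sub>C (- (Q z * a)) = Q z * (1 - z *\<^sub>C a)"
      by (simp add: right_diff_distrib mult_scaleC_right scaleC_minus_right)
    ultimately show ?thesis
      by (simp only: P_def mult.assoc power_commutes power_Suc)
  qed
  ultimately show ?case by (simp add: algebra_simps)
qed

text \<open>The polynomial \<open>(1 + z a)^n b (1 - z a)^n\<close> replaces \<open>exp (z a) b exp (- z a)\<close> of Le Page's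
  argument, which would need completeness. Since the norm is invariant under swapping factors, it
  is controlled by \<open>(1 - z\<^sup>2 a\<^sup>2)^n b\<close>, while its linear coefficient is \<open>n (a b - b a)\<close>; take
  \<open>n = m\<^sup>2\<close> and \<open>|z| = 1 / m\<close>.\<close>

lemma uniform_normed_algebra_commute:
  fixes a b :: "'a::{complex_normed_algebra, ring_1}"
  assumes "uniform_normed_algebra TYPE('a)"
  shows "a * b = b * a"
proof -
  interpret uniform_seminorm "norm :: 'a \<Rightarrow> real" by (rule uniform_seminorm_norm[OF assms])
  have bound: "norm ((1 + z *\<^sub>C a) ^ n * b * (1 - z *\<^sub>C a) ^ n)
      \<le> (1 + (cmod z * norm a)\<^sup>2) ^ n * norm b" for z n
  proof -
    define u where "u = 1 + z *\<^sub>C a"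
    define v where "v = 1 - z *\<^sub>C a"
    \<comment> \<open>Both products agree, so \<open>u\<close> and \<open>v\<close> commute and
      their \<open>n\<close>-th powers merge; the terms linear in \<open>z\<close> cancel.\<close>
    have vu: "v * u = 1 - (z *\<^sub>C a) * (z *\<^sub>C a)" "u * v = 1 - (z *\<^sub>C a) * (z *\<^sub>C a)"
      by (simp_all add: u_def v_def algebra_simps)
    have "norm (v * u) \<le> norm (1::'a) + norm ((z *\<^sub>C a) * (z *\<^sub>C a))"
      unfolding vu by (rule norm_triangle_ineq4)
    hence le: "norm (v * u) \<le> 1 + (cmod z * norm a)\<^sup>2"
      by (simp add: one square norm_scaleC)
    have "norm (u ^ n * b * v ^ n) \<le> norm (v ^ n * (u ^ n * b))" by (rule mult_le_swap)
    also have "v ^ n * (u ^ n * b) = (v * u) ^ n * b"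
      using vu by (simp add: mult_power_commuting flip: mult.assoc)
    also have "norm \<dots> \<le> norm ((v * u) ^ n) * norm b" by (rule norm_mult_ineq)
    also have "\<dots> \<le> (1 + (cmod z * norm a)\<^sup>2) ^ n * norm b"
      unfolding power by (intro mult_right_mono power_mono le) auto
    finally show ?thesis by (simp add: u_def v_def)
  qed
  have main: "real m * norm (a * b - b * a) \<le> exp ((norm a)\<^sup>2) * norm b" if "m > 0" for m :: nat
  proof -
    obtain c N where c: "N \<ge> 2" "c 1 = real (m\<^sup>2) *\<^sub>R (a * b - b * a)"
      "\<forall>z. (1 + z *\<^sub>C a) ^ m\<^sup>2 * b * (1 - z *\<^sub>C a) ^ m\<^sup>2 = (\<Sum>k<N. z ^ k *\<^sub>C c k)"
      using polynomial_with_coeffs01_conjugate[of a "m\<^sup>2" b]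
      unfolding polynomial_with_coeffs01_def by blast
    \<comment> \<open>The linear coefficient carries the factor \<open>m\<^sup>2\<close>, so the
      left side is \<open>m\<close> times the norm of the commutator, while the right side is
      bounded by a constant independent of \<open>m\<close>.\<close>
    have "(1 / real m) * norm (c 1) \<le> (1 + (1 / real m * norm a)\<^sup>2) ^ m\<^sup>2 * norm b"
    proof (rule polynomial_cauchy_estimate[OF c(1)])
      fix z assume "cmod z = 1 / real m"
      thus "norm (\<Sum>k<N. z ^ k *\<^sub>C c k) \<le> (1 + (1 / real m * norm a)\<^sup>2) ^ m\<^sup>2 * norm b"
        using bound[of z "m\<^sup>2"] c(3) by simp
    qed simp
    also have "\<dots> \<le> exp ((1 / real m * norm a)\<^sup>2) ^ m\<^sup>2 * norm b"
      by (intro mult_right_mono power_mono exp_ge_add_one_self) auto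
    also have "exp ((1 / real m * norm a)\<^sup>2) ^ m\<^sup>2 = exp ((norm a)\<^sup>2)"
      using that by (simp add: power_divide flip: exp_of_nat_mult)
    finally show ?thesis using that unfolding c(2) by (simp add: power2_eq_square)
  qed
  have "norm (a * b - b * a) = 0"
  proof (rule ccontr)
    assume "norm (a * b - b * a) \<noteq> 0"
    hence pos: "norm (a * b - b * a) > 0" by simp
    then obtain m :: nat where m: "exp ((norm a)\<^sup>2) * norm b < real m * norm (a * b - b * a)"
      using reals_Archimedean3 by blast
    moreover have "m > 0"
    proof (rule ccontr)
      assume "\<not> m > 0"
      with m have "exp ((norm a)\<^sup>2) * norm b < 0" by simp
      thus False by (simp add: mult_less_0_iff not_less)
    qed
    ultimately show False using main[of m] by simp
  qed
  thus ?thesis by simp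
qed


section \<open>Gelfand--Mazur for multiplicative seminorms\<close>

locale multiplicative_seminorm = uniform_seminorm p
  for p :: "'a::{complex_normed_algebra, ring_1} \<Rightarrow> real" +
  assumes mult: "p (a * b) = p a * p b"
begin

text \<open>Coercivity in \<open>c\<close>: this confines the minimization over scalars to a compact
  disc.\<close>

lemma scalar_ge: "cmod c \<le> p (a - c *\<^sub>C 1) + p a"
  using diff_le[of a "a - c *\<^sub>C 1"] by (simp add: scaleC one)

lemma scalar_dist_le: "p (a - d *\<^sub>C 1) \<le> p (a - c *\<^sub>C 1) + cmod (c - d)"
proof -
  have "a - d *\<^sub>C 1 = (a - c *\<^sub>C 1) + (c - d) *\<^sub>C 1" by (simp add: scaleC_diff_left)
  thus ?thesis using add_le[of "a - c *\<^sub>C 1" "(c - d) *\<^sub>C 1"] by (simp only: scaleC one mult_1_right)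
qed

lemma diff_square_factor: "p (b * b - (s * s) *\<^sub>C 1) = p (b - s *\<^sub>C 1) * p (b - (- s) *\<^sub>C 1)"
proof -
  have "(b - s *\<^sub>C 1) * (b - (- s) *\<^sub>C 1) = b * b - (s * s) *\<^sub>C 1"
    by (simp add: algebra_simps scaleC_minus_left mult_scaleC_left mult_scaleC_right scaleC_diff_right
        scaleC_scaleC)
  thus ?thesis by (simp flip: mult)
qed

text \<open>With a square root of \<open>c\<close>, the element factors as a difference of squares,
  and the induction hypothesis, valid for all scalars, bounds both factors.\<close>

lemma two_power_diff_ge:
  assumes "m > 0" "\<And>c. m \<le> p (b - c *\<^sub>C 1)"
  shows "m ^ (2 ^ k) \<le> p (b ^ (2 ^ k) - c *\<^sub>C 1)"
proof (induction k arbitrary: c)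
  case (Suc k)
  have "m ^ (2 ^ Suc k) = m ^ (2 ^ k) * m ^ (2 ^ k)" by (simp add: mult_2 power_add)
  also have "\<dots> \<le> p (b ^ (2 ^ k) - csqrt c *\<^sub>C 1) * p (b ^ (2 ^ k) - (- csqrt c) *\<^sub>C 1)"
    using assms(1) by (intro mult_mono Suc.IH nonneg) auto
  also have "\<dots> = p (b ^ (2 ^ Suc k) - c *\<^sub>C 1)"
    by (simp add: mult_2 power_add flip: diff_square_factor power2_eq_square)
  finally show ?case .
qed (simp add: assms)

text \<open>Here the factor \<open>b - c\<close> is retained, and only the cofactors
  \<open>b ^ (2 ^ k) + c ^ (2 ^ k)\<close> are bounded below. The extra \<open>m\<close> on the
  right avoids the exponent \<open>2 ^ k - 1\<close>.\<close>

lemma two_power_diff_ge':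
  assumes "m > 0" "\<And>c. m \<le> p (b - c *\<^sub>C 1)"
  shows "p (b - c *\<^sub>C 1) * m ^ (2 ^ k) \<le> m * p (b ^ (2 ^ k) - c ^ (2 ^ k) *\<^sub>C 1)"
proof (induction k)
  case (Suc k)
  have "p (b - c *\<^sub>C 1) * m ^ (2 ^ Suc k) = (p (b - c *\<^sub>C 1) * m ^ (2 ^ k)) * m ^ (2 ^ k)"
    by (simp add: mult_2 power_add)
  also have "\<dots> \<le> (m * p (b ^ (2 ^ k) - c ^ (2 ^ k) *\<^sub>C 1)) * p (b ^ (2 ^ k) - (- (c ^ (2 ^ k))) *\<^sub>C 1)"
    using assms(1) by (intro mult_mono Suc.IH two_power_diff_ge assms mult_nonneg_nonneg nonneg) auto
  also have "\<dots> = m * p (b ^ (2 ^ Suc k) - c ^ (2 ^ Suc k) *\<^sub>C 1)"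
    by (simp add: mult_2 power_add mult.assoc flip: diff_square_factor)
  finally show ?case .
qed simp

text \<open>Ostrowski's argument: comparing \<open>b^N - c^N\<close> with its factor \<open>b - c\<close>, the others being at least
  the minimum. Restricting to \<open>N = 2^k\<close> makes iterated square roots do for the roots of unity.\<close>

lemma minimum_spreads:
  assumes m: "m > 0" "\<And>c. m \<le> p (b - c *\<^sub>C 1)" and pb: "p b = m" and c: "cmod c < m"
  shows "p (b - c *\<^sub>C 1) = m"
proof -
  have "p (b - c *\<^sub>C 1) \<le> m * (1 + (cmod c / m) ^ (2 ^ k))" for k
  proof -
    have "p (b - c *\<^sub>C 1) * m ^ (2 ^ k) \<le> m * p (b ^ (2 ^ k) - c ^ (2 ^ k) *\<^sub>C 1)"
      using m by (rule two_power_diff_ge')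
    also have "\<dots> \<le> m * (p (b ^ (2 ^ k)) + p (c ^ (2 ^ k) *\<^sub>C 1))"
      using m by (intro mult_left_mono diff_le) auto
    also have "\<dots> = m * (1 + (cmod c / m) ^ (2 ^ k)) * m ^ (2 ^ k)"
      using m(1) by (simp add: power pb scaleC one norm_power power_divide field_simps)
    finally show ?thesis using m(1) by simp
  qed
  moreover have "(\<lambda>k. m * (1 + (cmod c / m) ^ (2 ^ k))) \<longlonglongrightarrow> m * (1 + 0)"
  proof (intro tendsto_intros)
    have "(\<lambda>n. (cmod c / m) ^ n) \<longlonglongrightarrow> 0"
      using m(1) c by (intro LIMSEQ_realpow_zero) auto
    moreover have "strict_mono (\<lambda>k::nat. 2 ^ k :: nat)" by (simp add: strict_mono_def)
    ultimately show "(\<lambda>k. (cmod c / m) ^ (2 ^ k)) \<longlonglongrightarrow> 0"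
      using LIMSEQ_subseq_LIMSEQ unfolding comp_def by blast
  qed
  ultimately have "p (b - c *\<^sub>C 1) \<le> m * (1 + 0)" by (intro LIMSEQ_le_const) auto
  thus ?thesis using m(2)[of c] by simp
qed

text \<open>The distance from \<open>a\<close> to the scalars is attained. Were it positive, the
  minimal value would spread to arbitrarily large scalars, contradicting coercivity.\<close>

lemma exists_scalar: "\<exists>c. p (a - c *\<^sub>C 1) = 0"
proof -
  have lip: "\<bar>p (a - c *\<^sub>C 1) - p (a - d *\<^sub>C 1)\<bar> \<le> dist c d" for c d
    using scalar_dist_le[of a c d] scalar_dist_le[of a d c]
    by (simp add: dist_norm norm_minus_commute abs_le_iff)
  \<comment> \<open>Outside this disc \<open>scalar_ge\<close> gives a value of at least
    \<open>p a\<close>, which is the value at \<open>c = 0\<close>; hence the minimum over the disc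
    is global.\<close>
  have "continuous_on (cball 0 (2 * p a)) (\<lambda>c. p (a - c *\<^sub>C 1))"
    unfolding continuous_on_iff dist_real_def by (meson le_less_trans lip)
  moreover have "cball (0::complex) (2 * p a) \<noteq> {}" using nonneg[of a] by simp
  ultimately obtain c0 where c0: "\<forall>c\<in>cball 0 (2 * p a). p (a - c0 *\<^sub>C 1) \<le> p (a - c *\<^sub>C 1)"
    using continuous_attains_inf[OF compact_cball, of "0::complex" "2 * p a"] by meson
  define m where "m = p (a - c0 *\<^sub>C 1)"
  have min: "m \<le> p (a - c *\<^sub>C 1)" for c
  proof (cases "c \<in> cball 0 (2 * p a)")
    case False
    hence "p a \<le> p (a - c *\<^sub>C 1)" using scalar_ge[of c a] by simp
    moreover have "m \<le> p a" using c0[THEN bspec, of 0] nonneg[of a] by (simp add: m_def)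
    ultimately show ?thesis by simp
  qed (use c0 m_def in auto)
  have "m = 0"
  proof (rule ccontr)
    assume "m \<noteq> 0"
    hence m: "m > 0" using nonneg by (simp add: m_def less_le)
    \<comment> \<open>A step of length \<open>m / 2\<close> satisfies the bound
      \<open>cmod c < m\<close> of \<open>minimum_spreads\<close>, so the minimum can be carried on
      from each new centre.\<close>
    define e where "e = complex_of_real (m / 2)"
    have "p (a - (c0 + of_nat n * e) *\<^sub>C 1) = m" for n
    proof (induction n)
      case (Suc n)
      define b where "b = a - (c0 + of_nat n * e) *\<^sub>C 1"
      have b: "b - c *\<^sub>C 1 = a - (c0 + of_nat n * e + c) *\<^sub>C 1" for c
        by (simp add: b_def scaleC_add_left)
      have "p (b - e *\<^sub>C 1) = m"
      proof (rule minimum_spreads[OF m])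
        show "m \<le> p (b - c *\<^sub>C 1)" for c unfolding b by (rule min)
        show "p b = m" using Suc.IH by (simp add: b_def)
        show "cmod e < m" using m by (simp add: e_def)
      qed
      thus ?case unfolding b by (simp add: algebra_simps)
    qed (simp add: m_def)
    hence "cmod (c0 + of_nat n * e) \<le> m + p a" for n
      using scalar_ge[of "c0 + of_nat n * e" a] by simp
    moreover have "real n * (m / 2) \<le> cmod (c0 + of_nat n * e) + cmod c0" for n
      using norm_triangle_ineq4[of "c0 + of_nat n * e" c0] m by (simp add: e_def norm_mult norm_divide)
    ultimately have "real n * (m / 2) \<le> m + p a + cmod c0" for n
      by (meson add_right_mono order_trans)
    moreover obtain n :: nat where "m + p a + cmod c0 < real n * (m / 2)"
      using reals_Archimedean3[of "m / 2"] m half_gt_zero by blast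
    ultimately show False by (meson not_le)
  qed
  thus ?thesis by (auto simp: m_def)
qed

lemma scalar_unique:
  assumes "p (a - c *\<^sub>C 1) = 0" "p (a - d *\<^sub>C 1) = 0"
  shows "c = d"
  using diff_le[of "a - d *\<^sub>C 1" "a - c *\<^sub>C 1"] assms
  by (simp add: scaleC one flip: scaleC_diff_left)

text \<open>The functional sends \<open>a\<close> to the unique scalar at distance zero from it; the
  algebraic laws follow by uniqueness.\<close>

lemma mult_functional_of_seminorm: "\<exists>f\<in>multiplicative_functionals. \<forall>a. cmod (f a) = p a"
proof -
  obtain f where f: "p (a - f a *\<^sub>C 1) = 0" for a using exists_scalar by metis
  have eqI: "f a = c" if "p (a - c *\<^sub>C 1) \<le> 0" for a c
    using scalar_unique[OF f[of a]] that nonneg[of "a - c *\<^sub>C 1"] by auto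
  have abs: "cmod (f a) = p a" for a
  proof (rule antisym)
    show "cmod (f a) \<le> p a" using scalar_ge[of "f a" a] f[of a] by simp
    show "p a \<le> cmod (f a)"
      using add_le[of "a - f a *\<^sub>C 1" "f a *\<^sub>C 1"] f[of a] by (simp add: scaleC one)
  qed
  have "f (a + b) = f a + f b" for a b
  proof (rule eqI)
    have "a + b - (f a + f b) *\<^sub>C 1 = (a - f a *\<^sub>C 1) + (b - f b *\<^sub>C 1)"
      by (simp add: scaleC_add_left)
    thus "p (a + b - (f a + f b) *\<^sub>C 1) \<le> 0"
      using add_le[of "a - f a *\<^sub>C 1" "b - f b *\<^sub>C 1"] f by (simp only: add_0)
  qed
  moreover have "f (c *\<^sub>C a) = c * f a" for c a
  proof (rule eqI)
    have "c *\<^sub>C a - (c * f a) *\<^sub>C 1 = c *\<^sub>C (a - f a *\<^sub>C 1)"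
      by (simp add: scaleC_diff_right scaleC_scaleC)
    thus "p (c *\<^sub>C a - (c * f a) *\<^sub>C 1) \<le> 0" using f by (simp add: scaleC)
  qed
  moreover have "f (a * b) = f a * f b" for a b
  proof (rule eqI)
    have "a * b - (f a * f b) *\<^sub>C 1 = (a - f a *\<^sub>C 1) * b + f a *\<^sub>C (b - f b *\<^sub>C 1)"
      by (simp add: left_diff_distrib mult_scaleC_left scaleC_diff_right scaleC_scaleC)
    thus "p (a * b - (f a * f b) *\<^sub>C 1) \<le> 0"
      using add_le[of "(a - f a *\<^sub>C 1) * b" "f a *\<^sub>C (b - f b *\<^sub>C 1)"] f
      by (simp add: mult scaleC)
  qed
  moreover have "f 1 \<noteq> 0" using abs[of 1] one by auto
  ultimately show ?thesis using abs
    by (intro bexI[of _ f]) (auto simp: multiplicative_functionals_def)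
qed

end


section \<open>Minimal uniform seminorms\<close>

text \<open>Dividing by the powers of \<open>u\<close> produces a smaller uniform seminorm; a minimal one must
  therefore be multiplicative.\<close>

lemma (in uniform_seminorm) localization:
  assumes comm: "\<And>a b :: 'a. a * b = b * a" and u: "p u > 0"
  obtains q where "uniform_seminorm q" "\<And>a. q a \<le> p a" "\<And>a. q a \<le> p (u * a) / p u"
    "\<And>a. (\<lambda>n. p (u ^ n * a) / p u ^ n) \<longlonglongrightarrow> q a"
proof -
  define g where "g a n = p (u ^ n * a) / p u ^ n" for a n
  have g0: "g a n \<ge> 0" for a n using nonneg by (simp add: g_def)
  have dec: "decseq (g a)" for a
  proof (rule decseq_SucI)
    fix n
    have "p (u ^ Suc n * a) \<le> p u * p (u ^ n * a)"
      using mult_le[of u "u ^ n * a"] by (simp add: mult.assoc)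
    thus "g a (Suc n) \<le> g a n" using u by (simp add: g_def field_simps)
  qed
  have "\<exists>l. g a \<longlonglongrightarrow> l" for a
    using decseq_convergent[OF dec[of a], of 0] g0[of a] by metis
  then obtain q where q: "g a \<longlonglongrightarrow> q a" for a by metis
  have q_le: "q a \<le> g a n" for a n by (rule decseq_ge[OF dec q])
  \<comment> \<open>At even exponents \<open>u ^ (n + n)\<close> shares out equally between two
    factors, so submultiplicativity and the square identity pass to the limit.\<close>
  have q2: "(\<lambda>n. g a (n + n)) \<longlonglongrightarrow> q a" for a
  proof -
    have "strict_mono (\<lambda>n::nat. n + n)" by (simp add: strict_mono_def)
    thus ?thesis using LIMSEQ_subseq_LIMSEQ[OF q[of a]] unfolding comp_def by blast
  qed
  have double: "u ^ (n + n) * (a * b) = (u ^ n * a) * (u ^ n * b)" for n a b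
    unfolding power_add by (metis comm mult.assoc)
  have "uniform_seminorm q"
  proof
    fix a b c
    show "q a \<ge> 0" using q[of a] g0 by (intro LIMSEQ_le_const) auto
    show "q (a + b) \<le> q a + q b"
    proof (rule LIMSEQ_le[OF q tendsto_add[OF q q]])
      have "g (a + b) n \<le> g a n + g b n" for n
        using add_le[of "u ^ n * a" "u ^ n * b"] u
        by (simp add: g_def distrib_left divide_right_mono flip: add_divide_distrib)
      thus "\<exists>N. \<forall>n\<ge>N. g (a + b) n \<le> g a n + g b n" by blast
    qed
    show "q (c *\<^sub>C a) \<le> cmod c * q a"
    proof (rule LIMSEQ_le[OF q tendsto_mult_left[OF q]])
      show "\<exists>N. \<forall>n\<ge>N. g (c *\<^sub>C a) n \<le> cmod c * g a n"
        by (simp add: g_def mult_scaleC_right scaleC)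
    qed
    show "q (a * b) \<le> q a * q b"
    proof (rule LIMSEQ_le[OF q2 tendsto_mult[OF q q]])
      have "g (a * b) (n + n) \<le> g a n * g b n" for n
        unfolding g_def double using mult_le[of "u ^ n * a" "u ^ n * b"] u
        by (simp add: power_add divide_right_mono)
      thus "\<exists>N. \<forall>n\<ge>N. g (a * b) (n + n) \<le> g a n * g b n" by blast
    qed
    have "(\<lambda>n. g (a * a) (n + n)) = (\<lambda>n. (g a n)\<^sup>2)"
      unfolding g_def double square by (simp add: power_add power_divide power2_eq_square)
    hence "(\<lambda>n. (g a n)\<^sup>2) \<longlonglongrightarrow> q (a * a)" using q2[of "a * a"] by simp
    moreover have "(\<lambda>n. (g a n)\<^sup>2) \<longlonglongrightarrow> (q a)\<^sup>2" by (intro tendsto_power q)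
    ultimately show "q (a * a) = (q a)\<^sup>2" by (rule LIMSEQ_unique)
    have "g 1 = (\<lambda>n. 1)" using u by (auto simp: g_def power)
    thus "q 1 = 1" using q[of 1] by (simp add: LIMSEQ_const_iff)
  qed
  moreover have "q a \<le> p a" for a using q_le[of a 0] by (simp add: g_def)
  moreover have "q a \<le> p (u * a) / p u" for a using q_le[of a 1] by (simp add: g_def)
  ultimately show thesis using that q unfolding g_def by blast
qed

text \<open>In a chain, the smaller of two members is close to the infimum at two given points
  simultaneously; this gives the laws involving two elements up to \<open>e\<close>, and
  \<open>e\<close> tends to 0.\<close>

lemma uniform_seminorm_chain_Inf:
  fixes C :: "('a::{complex_normed_algebra, ring_1} \<Rightarrow> real) set"
  assumes us: "\<And>p. p \<in> C \<Longrightarrow> uniform_seminorm p" and ne: "C \<noteq> {}"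
    and chain: "\<And>p q. p \<in> C \<Longrightarrow> q \<in> C \<Longrightarrow> (\<forall>a. p a \<le> q a) \<or> (\<forall>a. q a \<le> p a)"
  shows "uniform_seminorm (\<lambda>a. INF p\<in>C. p a)"
proof -
  define q where "q a = (INF p\<in>C. p a)" for a
  have nn: "p a \<ge> 0" if "p \<in> C" for p a using uniform_seminorm.nonneg[OF us[OF that]] .
  have q_le: "q a \<le> p a" if "p \<in> C" for p a
    unfolding q_def using nn that by (intro cINF_lower) (auto intro!: bdd_belowI2[of _ 0])
  have q_ge: "z \<le> q a" if "\<And>p. p \<in> C \<Longrightarrow> z \<le> p a" for z a
    unfolding q_def using ne that by (intro cINF_greatest) auto
  have q0: "q a \<ge> 0" for a using nn by (intro q_ge)
  have near1: "\<exists>p\<in>C. p a < q a + e" if "e > 0" for a e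
    using q_ge[of "q a + e" a] that by (meson add_le_same_cancel1 not_le)
  have near: "\<exists>p\<in>C. p a < q a + e \<and> p b < q b + e" if e: "e > 0" for a b e
  proof -
    obtain p1 p2 where "p1 \<in> C" "p1 a < q a + e" "p2 \<in> C" "p2 b < q b + e"
      using near1[OF e] by metis
    thus ?thesis using chain[of p1 p2] by (meson le_less_trans)
  qed
  have lim: "y \<le> h 0" if "\<And>e. e > 0 \<Longrightarrow> y \<le> h e" "isCont h 0" for y :: real and h :: "real \<Rightarrow> real"
  proof (rule tendsto_lowerbound)
    show "(h \<longlongrightarrow> h 0) (at_right 0)"
      using that(2) by (simp add: isCont_def filterlim_at_split)
    show "\<forall>\<^sub>F e in at_right 0. y \<le> h e"
      using that(1) by (auto simp: eventually_at_right_less intro: eventually_mono[OF eventually_at_right_less])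
  qed simp
  have "uniform_seminorm q"
  proof
    fix a b c
    show "q a \<ge> 0" by (rule q0)
    have "q (a + b) \<le> (q a + e) + (q b + e)" if e: "e > 0" for e
    proof -
      obtain p where p: "p \<in> C" "p a < q a + e" "p b < q b + e" using near[OF e] by blast
      show ?thesis
        using q_le[OF p(1), of "a + b"] uniform_seminorm.add_le[OF us[OF p(1)], of a b] p by linarith
    qed
    from lim[of _ "\<lambda>e. (q a + e) + (q b + e)", OF this]
    show "q (a + b) \<le> q a + q b" by simp
    have "q (c *\<^sub>C a) \<le> cmod c * (q a + e)" if e: "e > 0" for e
    proof -
      obtain p where p: "p \<in> C" "p a < q a + e" using near1[OF e] by blast
      have "q (c *\<^sub>C a) \<le> cmod c * p a"
        using q_le[OF p(1), of "c *\<^sub>C a"] uniform_seminorm.scaleC_le[OF us[OF p(1)], of c a] by linarith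
      also have "\<dots> \<le> cmod c * (q a + e)" using p by (intro mult_left_mono) auto
      finally show ?thesis .
    qed
    from lim[of _ "\<lambda>e. cmod c * (q a + e)", OF this]
    show "q (c *\<^sub>C a) \<le> cmod c * q a" by simp
    have mult_le: "q (a * b) \<le> q a * q b" for a b
    proof -
      have "q (a * b) \<le> (q a + e) * (q b + e)" if e: "e > 0" for e
      proof -
        obtain p where p: "p \<in> C" "p a < q a + e" "p b < q b + e" using near[OF e] by blast
        have "q (a * b) \<le> p a * p b"
          using q_le[OF p(1), of "a * b"] uniform_seminorm.mult_le[OF us[OF p(1)], of a b] by linarith
        also have "\<dots> \<le> (q a + e) * (q b + e)"
          using p nn[OF p(1)] q0[of a] e by (intro mult_mono) auto
        finally show ?thesis .
      qed
      from lim[of _ "\<lambda>e. (q a + e) * (q b + e)", OF this]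
      show "q (a * b) \<le> q a * q b" by simp
    qed
    show "q (a * b) \<le> q a * q b" by (rule mult_le)
    have "(q a)\<^sup>2 \<le> q (a * a)"
    proof (rule q_ge)
      fix p assume p: "p \<in> C"
      have "(q a)\<^sup>2 \<le> (p a)\<^sup>2" using q_le[OF p] q0 by (rule power_mono)
      thus "(q a)\<^sup>2 \<le> p (a * a)" by (simp add: uniform_seminorm.square[OF us[OF p]])
    qed
    thus "q (a * a) = (q a)\<^sup>2" using mult_le[of a a] by (simp add: power2_eq_square)
    have "(INF p\<in>C. p (1::'a)) = (INF p\<in>C. (1::real))"
      by (intro INF_cong) (auto simp: uniform_seminorm.one us)
    thus "q 1 = 1" using ne by (simp add: q_def)
  qed
  thus ?thesis by (simp add: q_def[abs_def])
qed

lemma exists_minimal_uniform_seminorm: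
  fixes x :: "'a::{complex_normed_algebra, ring_1}"
  assumes "uniform_seminorm p0" "p0 x = 1"
  obtains p where "uniform_seminorm p" "p x = 1"
    "\<And>q. uniform_seminorm q \<Longrightarrow> q x = 1 \<Longrightarrow> (\<And>a. q a \<le> p a) \<Longrightarrow> q = p"
proof -
  define S where "S = {p :: 'a \<Rightarrow> real. uniform_seminorm p \<and> p x = 1}"
  \<comment> \<open>The order is reversed, so that the maximal element supplied by Zorn's lemma is a
    minimal seminorm.\<close>
  define R where "R p q \<longleftrightarrow> (\<forall>a. q a \<le> p a)" for p q :: "'a \<Rightarrow> real"
  have "\<exists>m\<in>S. \<forall>a\<in>S. R m a \<longrightarrow> a = m"
  proof (rule predicate_Zorn)
    show "partial_order_on S (relation_of R S)"
      by (rule partial_order_on_relation_ofI) (auto simp: R_def fun_eq_iff intro: order_trans antisym)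
  next
    fix C assume C: "C \<in> Chains (relation_of R S)"
    have chain: "R p q \<or> R q p" if "p \<in> C" "q \<in> C" for p q
      using C that by (auto simp: Chains_def relation_of_def)
    have CS: "C \<subseteq> S" using C by (auto simp: Chains_def relation_of_def)
    show "\<exists>u\<in>S. \<forall>a\<in>C. R a u"
    proof (cases "C = {}")
      case True
      thus ?thesis using assms by (auto simp: S_def)
    next
      case False
      have us: "uniform_seminorm p" if "p \<in> C" for p using CS that by (auto simp: S_def)
      have "uniform_seminorm (\<lambda>a. INF p\<in>C. p a)"
        using chain by (intro uniform_seminorm_chain_Inf us False) (auto simp: R_def)
      moreover have "(INF p\<in>C. p x) = (INF p\<in>C. 1)"
        using CS by (intro INF_cong) (auto simp: S_def)
      hence "(INF p\<in>C. p x) = 1" using False by simp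
      moreover have "(INF p\<in>C. p a) \<le> p a" if "p \<in> C" for p a
        using uniform_seminorm.nonneg[OF us] that
        by (intro cINF_lower) (auto intro!: bdd_belowI2[of _ 0])
      ultimately show ?thesis
        by (intro bexI[of _ "\<lambda>a. INF p\<in>C. p a"]) (auto simp: S_def R_def)
    qed
  qed
  thus thesis using that unfolding S_def R_def by blast
qed

section \<open>Norming functionals and the equivalence\<close>

text \<open>Minimality is used twice: localizing at \<open>x\<close> shows that multiplication by
  \<open>x\<close> preserves \<open>p\<close>, and this makes localization at any \<open>u\<close>
  with \<open>p u > 0\<close> keep the value 1 at \<open>x\<close>.\<close>

lemma exists_mult_functional_norming:
  fixes x :: "'a::{complex_normed_algebra, ring_1}"
  assumes "uniform_normed_algebra TYPE('a)" "norm x = 1"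
  shows "\<exists>f\<in>multiplicative_functionals. cmod (f x) = 1"
proof -
  note comm = uniform_normed_algebra_commute[OF assms(1)]
  obtain p where p: "uniform_seminorm p" "p x = 1"
    and min: "\<And>q. uniform_seminorm q \<Longrightarrow> q x = 1 \<Longrightarrow> (\<And>a. q a \<le> p a) \<Longrightarrow> q = p"
    using exists_minimal_uniform_seminorm[OF uniform_seminorm_norm[OF assms(1)] assms(2)] by blast
  interpret uniform_seminorm p by (rule p(1))
  \<comment> \<open>The condition \<open>eq\<close> makes the localized seminorm equal to 1 at
    \<open>x\<close>. Minimality then identifies it with \<open>p\<close>, and the first term of its
    defining decreasing limit after the trivial one yields the reverse inequality.\<close>
  have step: "p (u * a) = p u * p a"
    if u: "p u > 0" and eq: "\<And>n. p (u ^ n * x) = p u ^ n" for u a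
  proof -
    obtain q where q: "uniform_seminorm q" "\<And>a. q a \<le> p a" "\<And>a. q a \<le> p (u * a) / p u"
      "\<And>a. (\<lambda>n. p (u ^ n * a) / p u ^ n) \<longlonglongrightarrow> q a"
      using localization[OF comm u] by blast
    have "q x = 1" using q(4)[of x] u by (simp add: eq LIMSEQ_const_iff)
    hence "q = p" using q(1,2) by (intro min) auto
    hence "p u * p a \<le> p (u * a)" using q(3)[of a] u by (simp add: field_simps)
    thus ?thesis using mult_le[of u a] by simp
  qed
  have x_mult: "p (x * a) = p a" for a
  proof -
    have "p (x ^ n * x) = p x ^ n" for n using power[of x "Suc n"] p(2) by (simp add: power_commutes)
    thus ?thesis using step[of x a] p(2) by simp
  qed
  interpret multiplicative_seminorm p
  proof
    fix a b
    show "p (a * b) = p a * p b"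
    proof (cases "p a = 0")
      case True
      thus ?thesis using mult_le[of a b] nonneg[of "a * b"] by simp
    next
      case False
      moreover have "p (a ^ n * x) = p a ^ n" for n by (simp add: comm[of _ x] x_mult power)
      ultimately show ?thesis using step[of a b] nonneg[of a] by simp
    qed
  qed
  show ?thesis using mult_functional_of_seminorm p(2) by metis
qed

theorem corollary2p4:
  assumes "functionally_continuous TYPE('a::{complex_normed_algebra, ring_1})"
  shows "saturated_normed_algebra TYPE('a) \<longleftrightarrow> uniform_normed_algebra TYPE('a)"
proof -
  have le: "cmod (f y) \<le> norm y" if "f \<in> multiplicative_functionals" for f and y :: 'a
    using assms that continuous_mult_functional_le_norm[of f y]
    by (auto simp: functionally_continuous_def)
  \<comment> \<open>Functional continuity bounds the supremum by 1 and the unit attains it, so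
    condition (b) just asks for \<open>f0\<close> with \<open>cmod (f0 x) = 1\<close>.\<close>
  have sup: "(SUP y \<in> {y::'a. norm y \<le> 1}. ereal (cmod (f y))) = 1"
    if f: "f \<in> multiplicative_functionals" and one: "norm (1::'a) = 1" for f
  proof (rule antisym)
    show "(SUP y \<in> {y::'a. norm y \<le> 1}. ereal (cmod (f y))) \<le> 1"
    proof (rule SUP_least)
      fix y :: 'a assume "y \<in> {y. norm y \<le> 1}"
      thus "ereal (cmod (f y)) \<le> 1" using le[OF f, of y] by simp
    qed
    have "ereal (cmod (f 1)) \<le> (SUP y \<in> {y::'a. norm y \<le> 1}. ereal (cmod (f y)))"
      using one by (intro SUP_upper) simp
    thus "1 \<le> (SUP y \<in> {y::'a. norm y \<le> 1}. ereal (cmod (f y)))"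
      by (simp add: mult_functional_one[OF f] one_ereal_def)
  qed
  show ?thesis
  proof
    assume sat: "saturated_normed_algebra TYPE('a)"
    hence one: "norm (1::'a) = 1" by (simp add: saturated_normed_algebra_def)
    have unit: "norm (x * x) \<ge> 1" if x: "norm x = 1" for x :: 'a
    proof -
      obtain f0 f where f: "f0 \<in> multiplicative_functionals" "f \<in> multiplicative_functionals"
        "ereal (cmod (f0 x)) = (SUP y \<in> {y::'a. norm y \<le> 1}. ereal (cmod (f y)))"
        using sat x unfolding saturated_normed_algebra_def by blast
      have "cmod (f0 x) = 1" using f(3) sup[OF f(2) one] by simp
      thus ?thesis using le[OF f(1), of "x * x"]
        by (simp add: mult_functional_mult[OF f(1)] norm_mult)
    qed
    have "norm (x * x) = (norm x)\<^sup>2" for x :: 'a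
    proof (cases "x = 0")
      case False
      define y where "y = (1 / norm x) *\<^sub>R x"
      have "norm (y * y) \<ge> 1" using False by (intro unit) (simp add: y_def)
      hence "(norm x)\<^sup>2 \<le> norm (x * x)"
        using False by (simp add: y_def power2_eq_square field_simps)
      thus ?thesis using norm_mult_ineq[of x x] by (simp add: power2_eq_square)
    qed simp
    thus "uniform_normed_algebra TYPE('a)" by (simp add: uniform_normed_algebra_def)
  next
    assume uni: "uniform_normed_algebra TYPE('a)"
    have one: "norm (1::'a) = 1"
      using uniform_seminorm.one[OF uniform_seminorm_norm[OF uni]] .
    show "saturated_normed_algebra TYPE('a)"
      unfolding saturated_normed_algebra_def
    proof (intro conjI allI impI one)
      fix x :: 'a assume "norm x = 1"
      then obtain f where f: "f \<in> multiplicative_functionals" "cmod (f x) = 1"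
        using exists_mult_functional_norming[OF uni] by blast
      thus "\<exists>f0\<in>multiplicative_functionals. \<exists>f\<in>multiplicative_functionals.
          ereal (cmod (f0 x)) = (SUP y \<in> {y::'a. norm y \<le> 1}. ereal (cmod (f y)))"
        \<comment> \<open>The same \<open>f\<close> serves in both roles.\<close>
        using sup[OF f(1) one] f by (intro bexI[of _ f]) simp_all
    qed
  qed
qed

end
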